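(* Let $(\mathfrak g,\{-,\cdots,-\})$ be an $n$-pre-Lie algebra. Then the induced $n$-bracket $$[x_1,\cdots,x_n]_C=\sum_{i=1}^n(-1)^{n-i}\{x_1,\cdots,\widehat{x_i},\cdots,x_n,x_i\}$$ defines an $n$-Lie algebra structure on $\mathfrak g$.
   Context: All vector spaces are finite dimensional over an algebraically closed field of characteristic $0$; $n\ge2$; a hat denotes omission. An $n$-Lie algebra is a vector space $\mathfrak g$ with a skew-symmetric linear map $[-,\cdots,-]_{\mathfrak g}:\wedge^n\mathfrak g\to\mathfrak g$ such that $[x_1,\cdots,x_{n-1},[y_1,\cdots,y_n]]=\sum_{i=1}^n[y_1,\cdots,y_{i-1},[x_1,\cdots,x_{n-1},y_i],y_{i+1},\cdots,y_n]$. An $n$-pre-Lie algebra is a vector space $\mathfrak g$ with a multilinear map $\{-,\cdots,-\}:\wedge^{n-1}\mathfrak g\otimes\mathfrak g\to\mathfrak g$ such that for all $x_i,y_j\in\mathfrak g$: (1) $\{x_1,\cdots,x_{n-1},\{y_1,\cdots,y_{n-1},y_n\}\}=\sum_{i=1}^{n-1}\{y_1,\cdots,y_{i-1},[x_1,\cdots,x_{n-1},y_i]_C,y_{i+1},\cdots,y_n\}+\{y_1,\cdots,y_{n-1},\{x_1,\cdots,x_{n-1},y_n\}\}$; (2) $\{[y_1,\cdots,y_n]_C,x_1,\cdots,x_{n-2},x_{n-1}\}=\sum_{i=1}^n(-1)^{n-i}\{y_1,\cdots,\widehat{y_i},\cdots,y_n,\{y_i,x_1,\cdots,x_{n-2},x_{n-1}\}\}$,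 where $[x_1,\cdots,x_n]_C=\sum_{i=1}^n(-1)^{n-i}\{x_1,\cdots,\widehat{x_i},\cdots,x_n,x_i\}$. *)

theory Defs
  imports Complex_Main "HOL-Computational_Algebra.Polynomial"
begin

text \<open>
  An \<open>n\<close>-ary operation on a vector space is a function on lists of which only the values on
  lists of length \<open>n\<close> matter. Indices are zero-based, so the sign \<open>(-1)\<^sup>n\<^sup>-\<^sup>i\<close> of the \<open>i\<close>-th
  summand in one-based counting is written with exponent \<open>n - Suc i\<close>.
\<close>

definition omit_nth :: "nat \<Rightarrow> 'a list \<Rightarrow> 'a list" where
  "omit_nth i xs = take i xs @ drop (Suc i) xs"

definition multilinear ::
  "('k::field \<Rightarrow> 'v::ab_group_add \<Rightarrow> 'v) \<Rightarrow> nat \<Rightarrow> ('v list \<Rightarrow> 'v) \<Rightarrow> bool" where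
  "multilinear scale n f \<longleftrightarrow>
     (\<forall>xs i. length xs = n \<longrightarrow> i < n \<longrightarrow> Vector_Spaces.linear scale scale (\<lambda>v. f (xs[i := v])))"

text \<open>
  A multilinear \<open>f\<close> of \<open>n\<close> arguments that is alternating in the first \<open>m\<close> of them is the same as
  a linear map on the tensor product of the \<open>m\<close>-th exterior power with \<open>n - m\<close> further factors.
  In characteristic \<open>0\<close> this is skew-symmetry in these arguments, see
  \<open>alternating_iff_skew_symmetric\<close> below.
\<close>

definition alternating :: "nat \<Rightarrow> nat \<Rightarrow> ('a list \<Rightarrow> 'v::zero) \<Rightarrow> bool" where
  "alternating m n f \<longleftrightarrow>
     (\<forall>xs i j. length xs = n \<longrightarrow> i < j \<longrightarrow> j < m \<longrightarrow> xs ! i = xs ! j \<longrightarrow> f xs = 0)"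

lemma alternating_iff_skew_symmetric:
  fixes scale :: "'k::field_char_0 \<Rightarrow> 'v::ab_group_add \<Rightarrow> 'v"
  assumes V: "vector_space scale" and f: "multilinear scale n f" and mn: "m \<le> n"
  shows "alternating m n f \<longleftrightarrow>
    (\<forall>xs i j. length xs = n \<longrightarrow> i < j \<longrightarrow> j < m \<longrightarrow> f (xs[i := xs ! j, j := xs ! i]) = - f xs)"
    (is "_ \<longleftrightarrow> ?skew")
proof
  assume alt: "alternating m n f"
  have add: "f (xs[i := u + v]) = f (xs[i := u]) + f (xs[i := v])"
    if "length xs = n" "i < n" for xs i u v
  proof -
    have "Vector_Spaces.linear scale scale (\<lambda>v. f (xs[i := v]))"
      using f that unfolding multilinear_def by blast
    then have "module_hom scale scale (\<lambda>v. f (xs[i := v]))"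
      by (simp add: Vector_Spaces.linear_def)
    then show ?thesis by (rule module_hom.add)
  qed
  show ?skew
  proof (intro allI impI)
    fix xs :: "'v list" and i j
    assume l: "length xs = n" and ij: "i < j" and jm: "j < m"
    define a b where "a = xs ! i" and "b = xs ! j"
    have zero: "f (xs[i := u, j := u]) = 0" for u
    proof -
      have "xs[i := u, j := u] ! i = xs[i := u, j := u] ! j"
        using l ij jm mn by (simp add: nth_list_update)
      then show ?thesis
        using alt l ij jm unfolding alternating_def by (metis length_list_update)
    qed
    have add2: "f (xs[i := u + v, j := w]) = f (xs[i := u, j := w]) + f (xs[i := v, j := w])"
      for u v w
      using add[of "xs[j := w]" i u v] l ij jm mn by (simp add: list_update_swap)
    have "0 = f (xs[i := a + b, j := a + b])" using zero by simp
    also have "\<dots> = f (xs[i := a, j := b]) + f (xs[i := b, j := a])"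
      using add[of "xs[i := a + b]" j a b] zero[of a] zero[of b] l ij jm mn by (simp add: add2)
    finally have "f (xs[i := b, j := a]) = - f (xs[i := a, j := b])"
      by (simp add: eq_neg_iff_add_eq_0 add.commute)
    then show "f (xs[i := xs ! j, j := xs ! i]) = - f xs"
      by (simp add: a_def b_def)
  qed
next
  assume skew: ?skew
  show "alternating m n f"
    unfolding alternating_def
  proof (intro allI impI)
    fix xs :: "'v list" and i j
    assume *: "length xs = n" "i < j" "j < m" "xs ! i = xs ! j"
    have "f (xs[i := xs ! j, j := xs ! i]) = - f xs"
      using skew * by blast
    moreover have "xs[i := xs ! j, j := xs ! i] = xs"
      using *(4) by (metis list_update_id)
    ultimately have "f xs + f xs = 0"
      by (simp add: eq_neg_iff_add_eq_0)
    then have "scale (1 + 1) (f xs) = 0"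
      using V by (simp only: vector_space_def)
    then show "f xs = 0"
      using vector_space.scale_eq_0_iff[OF V] by simp
  qed
qed

definition commutator ::
  "('k::field \<Rightarrow> 'v::ab_group_add \<Rightarrow> 'v) \<Rightarrow> nat \<Rightarrow> ('v list \<Rightarrow> 'v) \<Rightarrow> 'v list \<Rightarrow> 'v" where
  "commutator scale n p xs =
     (\<Sum>i<n. scale ((- 1) ^ (n - Suc i)) (p (omit_nth i xs @ [xs ! i])))"

text \<open>
  The set \<open>Basis\<close> only witnesses finite dimensionality; the axioms do not refer to it.
  In \<open>p_p\<close> and \<open>p_commutator\<close> the alternating arguments of \<open>p\<close> are the first \<open>n - 1\<close> list
  entries, and the list \<open>xs\<close> in \<open>p_commutator\<close> is the argument tuple \<open>x\<^sub>1, \<dots>, x\<^sub>n\<^sub>-\<^sub>1\<close>.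
\<close>

locale n_Lie_algebra = finite_dimensional_vector_space scale Basis
  for scale :: "'k::{alg_closed_field, field_char_0} \<Rightarrow> 'v::ab_group_add \<Rightarrow> 'v"
    and Basis :: "'v set" +
  fixes n :: nat and bracket :: "'v list \<Rightarrow> 'v"
  assumes n_ge_2: "2 \<le> n"
    and bracket_multilinear: "multilinear scale n bracket"
    and bracket_alternating: "alternating n n bracket"
    and fundamental_identity:
      "\<lbrakk>length xs = n - 1; length ys = n\<rbrakk> \<Longrightarrow>
        bracket (xs @ [bracket ys]) = (\<Sum>i<n. bracket (ys[i := bracket (xs @ [ys ! i])]))"

locale n_pre_Lie_algebra = finite_dimensional_vector_space scale Basis
  for scale :: "'k::{alg_closed_field, field_char_0} \<Rightarrow> 'v::ab_group_add \<Rightarrow> 'v"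
    and Basis :: "'v set" +
  fixes n :: nat and p :: "'v list \<Rightarrow> 'v"
  assumes n_ge_2: "2 \<le> n"
    and p_multilinear: "multilinear scale n p"
    and p_alternating: "alternating (n - 1) n p"
    and p_p:
      "\<lbrakk>length xs = n - 1; length ys = n - 1\<rbrakk> \<Longrightarrow>
        p (xs @ [p (ys @ [z])]) =
          (\<Sum>i<n - 1. p (ys[i := commutator scale n p (xs @ [ys ! i])] @ [z]))
          + p (ys @ [p (xs @ [z])])"
    and p_commutator:
      "\<lbrakk>length ys = n; length xs = n - 1\<rbrakk> \<Longrightarrow>
        p (commutator scale n p ys # xs) =
          (\<Sum>i<n. scale ((- 1) ^ (n - Suc i)) (p (omit_nth i ys @ [p (ys ! i # xs)])))"

end

theory Submission
  imports Defs
begin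

text \<open>
  Each bracket in the fundamental identity is expanded in terms of \<open>p\<close>. By the first axiom, the
  summand of \<open>[x\<^sub>1, \<dots>, x\<^sub>n\<^sub>-\<^sub>1, [y\<^sub>1, \<dots>, y\<^sub>n]]\<close> with the inner bracket in the last slot of \<open>p\<close> yields
  the terms in which some \<open>y\<^sub>k\<close> with \<open>k \<noteq> i\<close> is replaced by \<open>[x\<^sub>1, \<dots>, x\<^sub>n\<^sub>-\<^sub>1, y\<^sub>k]\<close> while \<open>y\<^sub>i\<close> stands in
  the last slot, and a remainder with \<open>p (x\<^sub>1, \<dots>, x\<^sub>n\<^sub>-\<^sub>1, y\<^sub>i)\<close> in the last slot. By the second axiom,
  the other summands complete this remainder to terms with \<open>[x\<^sub>1, \<dots>, x\<^sub>n\<^sub>-\<^sub>1, y\<^sub>i]\<close> in the last slot.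
\<close>

section \<open>Lists with one entry omitted, and their indexing\<close>

lemma length_omit_nth: "i < length xs \<Longrightarrow> length (omit_nth i xs) = length xs - 1"
  by (auto simp: omit_nth_def)

lemma omit_nth_update_same: "omit_nth i (xs[i := v]) = omit_nth i xs"
  by (simp add: omit_nth_def)

lemma omit_nth_append: "i < length xs \<Longrightarrow> omit_nth i (xs @ ys) = omit_nth i xs @ ys"
  by (simp add: omit_nth_def)

lemma omit_nth_length_append: "omit_nth (length xs) (xs @ y # ys) = xs @ ys"
  by (simp add: omit_nth_def)

lemma omit_nth_Suc_eq:
  assumes "Suc i < length xs" and "xs ! i = xs ! Suc i"
  shows "omit_nth (Suc i) xs = omit_nth i xs"
  using assms by (simp add: omit_nth_def take_Suc_conv_app_nth flip: Cons_nth_drop_Suc)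

text \<open>The increasing enumeration of the indices other than \<open>i\<close>. It sends a
  position in the list without entry \<open>i\<close> to the position that this entry had
  before.\<close>

definition skip :: "nat \<Rightarrow> nat \<Rightarrow> nat" where
  "skip i k = (if k < i then k else Suc k)"

lemma omit_nth_nth_skip:
  "i < length xs \<Longrightarrow> Suc k < length xs \<Longrightarrow> omit_nth i xs ! k = xs ! skip i k"
  by (auto simp: omit_nth_def skip_def nth_append min_def)

lemma omit_nth_update_skip:
  assumes "i < length xs" and "Suc k < length xs"
  shows "omit_nth i (xs[skip i k := v]) = (omit_nth i xs)[k := v]"
proof (rule nth_equalityI)
  show "length (omit_nth i (xs[skip i k := v])) = length ((omit_nth i xs)[k := v])"
    using assms by (simp add: length_omit_nth)
next
  fix j assume "j < length (omit_nth i (xs[skip i k := v]))"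
  then have "Suc j < length xs"
    using assms by (simp add: length_omit_nth)
  then show "omit_nth i (xs[skip i k := v]) ! j = (omit_nth i xs)[k := v] ! j"
    using assms
    by (cases "j = k") (auto simp: omit_nth_nth_skip length_omit_nth nth_list_update skip_def)
qed

lemma bij_betw_skip: "i < n \<Longrightarrow> bij_betw (skip i) {..<n - 1} ({..<n} - {i})"
  by (rule bij_betw_byWitness[where f' = "\<lambda>l. if l < i then l else l - 1"])
     (auto simp: skip_def)

lemma sum_lessThan_skip:
  fixes g :: "nat \<Rightarrow> 'a::comm_monoid_add"
  assumes "i < n"
  shows "(\<Sum>l<n. g l) = g i + (\<Sum>k<n - 1. g (skip i k))"
proof -
  have "(\<Sum>l<n. g l) = g i + (\<Sum>l\<in>{..<n} - {i}. g l)"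
    using assms by (intro sum.remove) auto
  also have "(\<Sum>l\<in>{..<n} - {i}. g l) = (\<Sum>k<n - 1. g (skip i k))"
    using sum.reindex_bij_betw[OF bij_betw_skip[OF assms], of g] by simp
  finally show ?thesis .
qed

section \<open>Multilinear and alternating maps\<close>

context vector_space
begin

lemma multilinear_update:
  assumes "multilinear scale n f" and "length xs = n" and "i < n"
  shows "module_hom scale scale (\<lambda>v. f (xs[i := v]))"
  using assms by (auto simp: multilinear_def Vector_Spaces.linear_def)

lemma multilinear_append:
  assumes "multilinear scale n f" and "length xs + Suc (length ys) = n"
  shows "module_hom scale scale (\<lambda>v. f (xs @ v # ys))"
  using multilinear_update[OF assms(1), of "xs @ undefined # ys" "length xs"] assms(2) by simp

text \<open>Vanishing on equal neighbours makes each adjacent transposition change the sign, and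
  such transpositions bring two distant equal entries together.\<close>

lemma alternating_of_adjacent:
  assumes f: "multilinear scale n f" and "m \<le> n"
    and adj: "\<And>xs i. \<lbrakk>length xs = n; Suc i < m; xs ! i = xs ! Suc i\<rbrakk> \<Longrightarrow> f xs = 0"
  shows "alternating m n f"
proof -
  have swap: "f (xs[j := u, Suc j := v]) = - f (xs[j := v, Suc j := u])"
    if xs: "length xs = n" and j: "Suc j < m" for xs j u v
  proof -
    have zero: "f (xs[j := a, Suc j := a]) = 0" for a
      using xs j \<open>m \<le> n\<close> by (intro adj[of _ j]) (simp_all add: nth_list_update)
    have addl: "f (xs[j := a + b, Suc j := c]) = f (xs[j := a, Suc j := c]) + f (xs[j := b, Suc j := c])" for a b c
      using module_hom.add[OF multilinear_update[OF f, of "xs[Suc j := c]" j]] xs j \<open>m \<le> n\<close>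
      by (simp add: list_update_swap)
    have addr: "f (xs[j := c, Suc j := a + b]) = f (xs[j := c, Suc j := a]) + f (xs[j := c, Suc j := b])" for a b c
      using module_hom.add[OF multilinear_update[OF f, of "xs[j := c]" "Suc j"]] xs j \<open>m \<le> n\<close>
      by simp
    \<comment> \<open>Polarization: expanding the value at \<open>u + v\<close> in both slots leaves
      only the two mixed terms.\<close>
    show ?thesis
      using zero[of u] zero[of v] zero[of "u + v"]
      by (simp add: addl addr eq_neg_iff_add_eq_0 add.commute)
  qed
  \<comment> \<open>Here \<open>d\<close> counts the entries strictly between the two equal ones; a
    swap of the right one with its left neighbour lowers it by one.\<close>
  have gap: "f xs = 0" if "length xs = n" "Suc (i + d) < m" "xs ! i = xs ! Suc (i + d)" for xs i d
    using that
  proof (induction d arbitrary: xs)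
    case 0
    then show ?case using adj by simp
  next
    case (Suc d)
    let ?j = "Suc (i + d)"
    let ?ys = "xs[?j := xs ! Suc ?j, Suc ?j := xs ! ?j]"
    have "f ?ys = 0"
      using Suc.prems \<open>m \<le> n\<close> by (intro Suc.IH) (simp_all add: nth_list_update)
    then show ?case
      using swap[of xs ?j "xs ! ?j" "xs ! Suc ?j"] Suc.prems by simp
  qed
  show ?thesis
    unfolding alternating_def
  proof (intro allI impI)
    fix xs :: "'b list" and i j
    assume "length xs = n" "i < j" "j < m" "xs ! i = xs ! j"
    then show "f xs = 0"
      using gap[of xs i "j - Suc i"] by simp
  qed
qed

text \<open>The entry \<open>w\<close> moves left past \<open>zs\<close> one place at a time, each
  at the cost of a sign. The bound by \<open>m\<close> keeps all these moves inside the alternating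
  slots.\<close>

lemma alternating_rotate:
  assumes f: "multilinear scale n f" and alt: "alternating m n f" and "m \<le> n"
    and "length as + length zs < m" and "length as + length zs + Suc (length bs) = n"
  shows "f (as @ zs @ w # bs) = scale ((- 1) ^ length zs) (f (as @ w # zs @ bs))"
  using assms(4,5)
proof (induction zs arbitrary: as)
  case Nil
  then show ?case by simp
next
  case (Cons z zs)
  have zero: "f (as @ a # a # zs @ bs) = 0" for a
    using alt Cons.prems
    unfolding alternating_def
    by (elim allE[of _ "as @ a # a # zs @ bs"] allE[of _ "length as"] allE[of _ "Suc (length as)"])
       (simp add: nth_append)
  have "f (as @ a # (u + v) # zs @ bs) = f (as @ a # u # zs @ bs) + f (as @ a # v # zs @ bs)" for a u v
    using module_hom.add[OF multilinear_append[OF f, of "as @ [a]" "zs @ bs"]] Cons.prems by simp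
  moreover have "f (as @ (u + v) # a # zs @ bs) = f (as @ u # a # zs @ bs) + f (as @ v # a # zs @ bs)" for a u v
    using module_hom.add[OF multilinear_append[OF f, of "as" "a # zs @ bs"]] Cons.prems by simp
  ultimately have "f (as @ z # w # zs @ bs) = - f (as @ w # z # zs @ bs)"
    using zero[of z] zero[of w] zero[of "z + w"]
    by (simp add: eq_neg_iff_add_eq_0 add.commute)
  moreover have "f ((as @ [z]) @ zs @ w # bs) = scale ((- 1) ^ length zs) (f ((as @ [z]) @ w # zs @ bs))"
    using Cons.prems by (intro Cons.IH) simp_all
  ultimately show ?case
    by (simp add: scale_minus_left scale_minus_right)
qed

section \<open>Multilinearity and skew-symmetry of the commutator\<close>

lemma multilinear_commutator:
  assumes p: "multilinear scale n p" and n: "n > 0"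
  shows "multilinear scale n (commutator scale n p)"
  unfolding multilinear_def
proof (intro allI impI)
  fix xs :: "'b list" and j
  assume xs: "length xs = n" and j: "j < n"
  interpret vector_space_pair scale scale ..
  have "module_hom scale scale (\<lambda>v. p (omit_nth i (xs[j := v]) @ [xs[j := v] ! i]))"
    if i: "i < n" for i
  \<comment> \<open>In the \<open>i\<close>-th summand, entry \<open>j\<close> stands in the last
    slot of \<open>p\<close> if \<open>j = i\<close>, and otherwise in the slot \<open>k\<close>
    with \<open>skip i k = j\<close>.\<close>
  proof (cases "j = i")
    case True
    then show ?thesis
      using multilinear_append[OF p, of "omit_nth i xs" "[]"] xs i
      by (simp add: omit_nth_update_same length_omit_nth)
  next
    case False
    then have "j \<in> skip i ` {..<n - 1}"
      using bij_betw_skip[OF i] j by (auto simp: bij_betw_def)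
    then obtain k where k: "k < n - 1" "j = skip i k" by auto
    then have "omit_nth i (xs[j := v]) @ [xs[j := v] ! i] = (omit_nth i xs @ [xs ! i])[k := v]" for v
      using xs i False by (simp add: omit_nth_update_skip list_update_append length_omit_nth)
    then show ?thesis
      using multilinear_update[OF p, of "omit_nth i xs @ [xs ! i]" k] xs i k
      by (simp add: length_omit_nth)
  qed
  then have "module_hom scale scale (\<lambda>v. commutator scale n p (xs[j := v]))"
    unfolding commutator_def
    by (intro vector_space_pair.linear_compose_sum[OF vector_space_pair_axioms, unfolded linear_iff_module_hom]
          ballI module_pair.module_hom_scale[OF module_pair_axioms]) simp
  then show "Vector_Spaces.linear scale scale (\<lambda>v. commutator scale n p (xs[j := v]))"
    by (simp add: linear_iff_module_hom)
qed

text \<open>If entries \<open>i\<close> and \<open>Suc i\<close> agree, every summand that omits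
  neither of them vanishes because \<open>p\<close> is alternating, and the two that omit one of
  them cancel. Restricting to neighbours makes this cancellation a matter of consecutive
  signs.\<close>

lemma alternating_commutator:
  assumes p: "multilinear scale n p" and alt: "alternating (n - 1) n p" and n: "n > 0"
  shows "alternating n n (commutator scale n p)"
proof (rule alternating_of_adjacent[OF multilinear_commutator[OF p n] order.refl])
  fix xs :: "'b list" and i
  assume xs: "length xs = n" and i: "Suc i < n" and eq: "xs ! i = xs ! Suc i"
  let ?g = "\<lambda>l. scale ((- 1) ^ (n - Suc l)) (p (omit_nth l xs @ [xs ! l]))"
  have zero: "?g l = 0" if l: "l < n" "l \<noteq> i" "l \<noteq> Suc i" for l
  proof -
    \<comment> \<open>The position of entry \<open>i\<close> after entry \<open>l\<close> is
      removed. As \<open>l\<close> is neither \<open>i\<close> nor \<open>Suc i\<close>, the equal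
      entries stay adjacent and within the first \<open>n - 1\<close> slots.\<close>
    define a where "a = (if i < l then i else i - 1)"
    have a: "skip l a = i" "skip l (Suc a) = Suc i" "Suc a < n - 1"
      using l i by (auto simp: a_def skip_def)
    then have "(omit_nth l xs @ [xs ! l]) ! a = (omit_nth l xs @ [xs ! l]) ! Suc a"
      using l xs eq by (simp add: nth_append length_omit_nth omit_nth_nth_skip)
    then have "p (omit_nth l xs @ [xs ! l]) = 0"
      using alt a l xs unfolding alternating_def
      by (metis One_nat_def length_append_singleton length_omit_nth lessI Suc_pred n)
    then show ?thesis by simp
  qed
  have "commutator scale n p xs = (\<Sum>l\<in>{i, Suc i}. ?g l)"
    unfolding commutator_def using i zero by (intro sum.mono_neutral_right) auto
  \<comment> \<open>The exponents differ by one, so the signs are opposite, while omitting either of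
    two equal neighbours leaves the same list.\<close>
  also have "n - Suc i = Suc (n - Suc (Suc i))"
    using i by simp
  then have "(\<Sum>l\<in>{i, Suc i}. ?g l) = 0"
    using omit_nth_Suc_eq[of i xs] xs i eq by (simp add: scale_minus_left)
  finally show "commutator scale n p xs = 0" .
qed

text \<open>This separates the summand with \<open>w\<close> in the last slot of \<open>p\<close>,
  to which the first axiom applies, from those with \<open>w\<close> in the penultimate slot, which
  call for the second.\<close>

lemma commutator_snoc:
  assumes xs: "length xs = n - 1" and n: "n > 0"
  shows "commutator scale n p (xs @ [w]) =
    (\<Sum>j<n - 1. scale ((- 1) ^ (n - Suc j)) (p (omit_nth j xs @ [w, xs ! j]))) + p (xs @ [w])"
proof -
  obtain m where m: "n = Suc m" using n by (cases n) auto
  then show ?thesis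
    using xs omit_nth_length_append[of xs w "[]"]
    by (simp add: commutator_def omit_nth_append nth_append)
qed

end

section \<open>The fundamental identity\<close>

context n_pre_Lie_algebra
begin

abbreviation C :: "'v list \<Rightarrow> 'v" where
  "C \<equiv> commutator scale n p"

lemma p_snoc_commutator:
  assumes xs: "length xs = n - 1" and ys: "length ys = n"
  shows "p (xs @ [C ys]) = (\<Sum>i<n. scale ((- 1) ^ (n - Suc i))
    ((\<Sum>k<n - 1. p ((omit_nth i ys)[k := C (xs @ [ys ! skip i k])] @ [ys ! i]))
      + p (omit_nth i ys @ [p (xs @ [ys ! i])])))"
proof -
  interpret h: module_hom scale scale "\<lambda>v. p (xs @ [v])"
    using multilinear_append[OF p_multilinear, of xs "[]"] xs n_ge_2 by simp
  have "p (xs @ [C ys]) = (\<Sum>i<n. scale ((- 1) ^ (n - Suc i)) (p (xs @ [p (omit_nth i ys @ [ys ! i])])))"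
    by (simp add: commutator_def h.sum h.scale)
  also have "\<dots> = (\<Sum>i<n. scale ((- 1) ^ (n - Suc i))
    ((\<Sum>k<n - 1. p ((omit_nth i ys)[k := C (xs @ [ys ! skip i k])] @ [ys ! i]))
      + p (omit_nth i ys @ [p (xs @ [ys ! i])])))"
  proof (intro sum.cong[OF refl] arg_cong[where f = "scale _"])
    fix i assume "i \<in> {..<n}"
    then have i: "i < n" by simp
    then have "(\<Sum>k<n - 1. p ((omit_nth i ys)[k := C (xs @ [omit_nth i ys ! k])] @ [ys ! i])) =
        (\<Sum>k<n - 1. p ((omit_nth i ys)[k := C (xs @ [ys ! skip i k])] @ [ys ! i]))"
      using ys by (intro sum.cong) (simp_all add: omit_nth_nth_skip)
    then show "p (xs @ [p (omit_nth i ys @ [ys ! i])]) =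
        (\<Sum>k<n - 1. p ((omit_nth i ys)[k := C (xs @ [ys ! skip i k])] @ [ys ! i]))
          + p (omit_nth i ys @ [p (xs @ [ys ! i])])"
      using p_p[OF xs, of "omit_nth i ys" "ys ! i"] i ys by (simp add: length_omit_nth)
  qed
  finally show ?thesis .
qed

text \<open>Brings the penultimate argument to the front, where the second axiom expects the
  bracket. The sign \<open>(-1) ^ (n - 2)\<close> equals \<open>(-1) ^ n\<close>.\<close>

lemma p_penultimate_rotate:
  assumes "length zs = n - 2"
  shows "p (zs @ [w, v]) = scale ((- 1) ^ n) (p (w # zs @ [v]))"
  using alternating_rotate[OF p_multilinear p_alternating, of "[]" zs "[v]" w] assms n_ge_2
  by (auto simp: minus_one_power_iff)

text \<open>The second axiom carries over to a bracket in the penultimate slot: rotation to the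
  front contributes the same factor \<open>(-1) ^ n\<close> on both sides.\<close>

lemma p_penultimate_commutator:
  assumes zs: "length zs = n - 2" and ys: "length ys = n"
  shows "p (zs @ [C ys, v]) =
    (\<Sum>i<n. scale ((- 1) ^ (n - Suc i)) (p (omit_nth i ys @ [p (zs @ [ys ! i, v])])))"
proof -
  have hom: "p (omit_nth i ys @ [scale c u]) = scale c (p (omit_nth i ys @ [u]))" if "i < n" for i c u
    using module_hom.scale[OF multilinear_append[OF p_multilinear, of "omit_nth i ys" "[]"]]
      ys n_ge_2 that by (simp add: length_omit_nth)
  have "p (zs @ [C ys, v]) = scale ((- 1) ^ n)
      (\<Sum>i<n. scale ((- 1) ^ (n - Suc i)) (p (omit_nth i ys @ [p (ys ! i # zs @ [v])])))"
    using zs ys n_ge_2 by (simp add: p_penultimate_rotate p_commutator)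
  also have "\<dots> = (\<Sum>i<n. scale ((- 1) ^ (n - Suc i)) (p (omit_nth i ys @ [p (zs @ [ys ! i, v])])))"
    using zs by (simp add: scale_sum_right p_penultimate_rotate hom mult.commute)
  finally show ?thesis .
qed

text \<open>After exchanging the two sums, \<open>i\<close> marks the entry in the last slot of
  \<open>p\<close> and \<open>l\<close> the replaced one. The diagonal \<open>l = i\<close> gives
  the first term, and the other \<open>l\<close> are written as \<open>skip i k\<close>.\<close>

lemma sum_commutator_update:
  assumes ys: "length ys = n"
  shows "(\<Sum>l<n. C (ys[l := w l])) = (\<Sum>i<n. scale ((- 1) ^ (n - Suc i))
    (p (omit_nth i ys @ [w i]) + (\<Sum>k<n - 1. p ((omit_nth i ys)[k := w (skip i k)] @ [ys ! i]))))"
proof -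
  have "(\<Sum>l<n. C (ys[l := w l])) = (\<Sum>i<n. \<Sum>l<n. scale ((- 1) ^ (n - Suc i))
      (p (omit_nth i (ys[l := w l]) @ [ys[l := w l] ! i])))"
    unfolding commutator_def by (rule sum.swap)
  also have "\<dots> = (\<Sum>i<n. scale ((- 1) ^ (n - Suc i))
      (p (omit_nth i ys @ [w i]) + (\<Sum>k<n - 1. p ((omit_nth i ys)[k := w (skip i k)] @ [ys ! i]))))"
  proof (rule sum.cong[OF refl])
    fix i assume "i \<in> {..<n}"
    then have i: "i < n" by simp
    have "skip i k \<noteq> i" for k
      by (simp add: skip_def)
    then have "(\<Sum>l<n. p (omit_nth i (ys[l := w l]) @ [ys[l := w l] ! i])) =
      p (omit_nth i ys @ [w i]) + (\<Sum>k<n - 1. p ((omit_nth i ys)[k := w (skip i k)] @ [ys ! i]))"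
      using i ys by (simp add: sum_lessThan_skip[OF i] omit_nth_update_same omit_nth_update_skip)
    then show "(\<Sum>l<n. scale ((- 1) ^ (n - Suc i)) (p (omit_nth i (ys[l := w l]) @ [ys[l := w l] ! i])))
      = scale ((- 1) ^ (n - Suc i))
      (p (omit_nth i ys @ [w i]) + (\<Sum>k<n - 1. p ((omit_nth i ys)[k := w (skip i k)] @ [ys ! i])))"
      by (simp flip: scale_sum_right)
  qed
  finally show ?thesis .
qed

lemma commutator_fundamental_identity:
  assumes xs: "length xs = n - 1" and ys: "length ys = n"
  shows "C (xs @ [C ys]) = (\<Sum>i<n. C (ys[i := C (xs @ [ys ! i])]))"
proof -
  let ?s = "\<lambda>i. (- 1) ^ (n - Suc i)"
  \<comment> \<open>\<open>?D u\<close> is the part of \<open>C (xs @ [u])\<close> in which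
    \<open>u\<close> is not in the last slot of \<open>p\<close>.\<close>
  let ?D = "\<lambda>u. (\<Sum>j<n - 1. scale (?s j) (p (omit_nth j xs @ [u, xs ! j])))"
  have D: "?D (C ys) = (\<Sum>i<n. scale (?s i) (p (omit_nth i ys @ [?D (ys ! i)])))"
  proof -
    have hom: "p (omit_nth i ys @ [?D (ys ! i)]) =
        (\<Sum>j<n - 1. scale (?s j) (p (omit_nth i ys @ [p (omit_nth j xs @ [ys ! i, xs ! j])])))"
      if "i < n" for i
    proof -
      interpret h: module_hom scale scale "\<lambda>v. p (omit_nth i ys @ [v])"
        using multilinear_append[OF p_multilinear, of "omit_nth i ys" "[]"] ys n_ge_2 that
        by (simp add: length_omit_nth)
      show ?thesis by (simp add: h.sum h.scale)
    qed
    have "?D (C ys) = (\<Sum>j<n - 1. \<Sum>i<n. scale (?s j) (scale (?s i)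
        (p (omit_nth i ys @ [p (omit_nth j xs @ [ys ! i, xs ! j])]))))"
      using xs ys by (simp add: p_penultimate_commutator length_omit_nth scale_sum_right)
    also have "\<dots> = (\<Sum>i<n. scale (?s i) (p (omit_nth i ys @ [?D (ys ! i)])))"
      by (subst sum.swap) (simp add: hom scale_sum_right mult.commute del: One_nat_def)
    finally show ?thesis .
  qed
  \<comment> \<open>The contribution of \<open>?D\<close> is what the remainder from the first axiom
    lacks to have a full bracket in the last slot.\<close>
  have split: "p (omit_nth i ys @ [C (xs @ [ys ! i])]) =
      p (omit_nth i ys @ [?D (ys ! i)]) + p (omit_nth i ys @ [p (xs @ [ys ! i])])" if "i < n" for i
    using module_hom.add[OF multilinear_append[OF p_multilinear, of "omit_nth i ys" "[]"]]
      ys xs n_ge_2 that by (simp add: length_omit_nth commutator_snoc)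
  have "C (xs @ [C ys]) = ?D (C ys) + p (xs @ [C ys])"
    using xs n_ge_2 by (simp add: commutator_snoc)
  also have "\<dots> = (\<Sum>i<n. C (ys[i := C (xs @ [ys ! i])]))"
    unfolding D p_snoc_commutator[OF xs ys] sum_commutator_update[OF ys]
      sum.distrib[symmetric] scale_right_distrib[symmetric]
    by (intro sum.cong arg_cong[where f = "scale _"]) (simp_all add: split add.assoc add.commute add.left_commute)
  finally show ?thesis .
qed

end

theorem proposition3p14:
  fixes scale :: "'k::{alg_closed_field, field_char_0} \<Rightarrow> 'v::ab_group_add \<Rightarrow> 'v"
    and Basis :: "'v set" and n :: nat and p :: "'v list \<Rightarrow> 'v"
  assumes "n_pre_Lie_algebra scale Basis n p"
  shows "n_Lie_algebra scale Basis n (commutator scale n p)"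
proof -
  interpret n_pre_Lie_algebra scale Basis n p by fact
  show ?thesis
  proof unfold_locales
    show "2 \<le> n" by (rule n_ge_2)
    show "multilinear scale n (commutator scale n p)"
      using multilinear_commutator[OF p_multilinear] n_ge_2 by simp
    show "alternating n n (commutator scale n p)"
      using alternating_commutator[OF p_multilinear p_alternating] n_ge_2 by simp
  qed (rule commutator_fundamental_identity)
qed

end
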